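(* Let $p$ be an odd prime, and let $g$ be a positive integer with $g\mid p-1$. Then $$G(g,p-1)\le \frac{p(p-1)}{g}-\left\lceil \frac{3p-1-g}{2g}\right\rceil.$$ In particular, for fixed $g$, $$G(g,p-1)\le \frac{p(p-1)}{g}-\frac{3p}{2g}+O_g(1),$$ where $p$ ranges over odd primes with $g\mid p-1$ and $O_g(1)$ denotes a quantity bounded in absolute value by a constant depending only on $g$.
   Context: A finite set $\mathcal{G}\subset\mathbb{Z}$ is a $g$-Golomb ruler if for every positive integer $d$ the number of pairs $(a,c)\in \mathcal{G}^2$ with $c-a=d$ is at most $g$. $G(g,n)$ denotes the minimum possible diameter (largest element minus smallest element) of a $g$-Golomb ruler with exactly $n$ elements (marks). *)

theory Defs
  imports Complex_Main "HOL-Computational_Algebra.Primes"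
begin

definition golomb_ruler :: "nat \<Rightarrow> int set \<Rightarrow> bool" where
  "golomb_ruler g A \<longleftrightarrow>
     finite A \<and> (\<forall>d>0. card {(a, c). a \<in> A \<and> c \<in> A \<and> c - a = d} \<le> g)"

definition diam :: "int set \<Rightarrow> nat" where
  "diam A = nat (Max A - Min A)"

(* Meaningful for g, n > 0: then a ruler with n marks exists (so that LEAST is attained),
   and it is nonempty (so that Max and Min are meaningful). *)
definition min_diam :: "nat \<Rightarrow> nat \<Rightarrow> nat" where
  "min_diam g n = (LEAST D. \<exists>A. golomb_ruler g A \<and> card A = n \<and> diam A = D)"

end

theory Submission
  imports Defs "HOL-Number_Theory.Residue_Primitive_Roots"
begin

section \<open>Sums of integers with bounded multiplicity\<close>

text \<open>The extreme case takes each of the \<open>k\<close> largest allowed values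
  \<open>L\<close>, \<open>L - 1\<close>, ..., \<open>L - k + 1\<close> exactly \<open>g\<close>
  times. To compare with it, shift the terms by \<open>k - L\<close>, drop those that are not
  positive and group the rest by value: the shifted value \<open>t\<close> in \<open>{1..k}\<close>
  contributes at most \<open>g * t\<close>.\<close>

lemma sum_le_of_bounded_multiplicity:
  fixes h :: "'a \<Rightarrow> int" and L :: int and g k :: nat
  assumes "finite I" "card I = g * k" "\<And>i. i \<in> I \<Longrightarrow> h i \<le> L"
    and mult: "\<And>v. card {i \<in> I. h i = v} \<le> g"
  shows "2 * (\<Sum>i\<in>I. h i) \<le> int (g * k) * (2 * L - int k + 1)"
proof -
  let ?J = "{i \<in> I. L - int k < h i}"
  have "(\<Sum>i\<in>I. int k + h i - L) \<le> (\<Sum>i\<in>I. if L - int k < h i then int k + h i - L else 0)"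
    by (intro sum_mono) auto
  also have "\<dots> = (\<Sum>i\<in>?J. int k + h i - L)"
    using assms(1) by (simp add: sum.inter_filter)
  also have "\<dots> = (\<Sum>v\<in>{L - int k<..L}. \<Sum>i\<in>{i \<in> ?J. h i = v}. int k + h i - L)"
    using assms by (intro sum.group[symmetric]) auto
  also have "\<dots> \<le> (\<Sum>v\<in>{L - int k<..L}. int g * (int k + v - L))"
  proof (intro sum_mono)
    fix v assume v: "v \<in> {L - int k<..L}"
    have "(\<Sum>i\<in>{i \<in> ?J. h i = v}. int k + h i - L) = int (card {i \<in> ?J. h i = v}) * (int k + v - L)"
      by simp
    also have "card {i \<in> ?J. h i = v} = card {i \<in> I. h i = v}"
      using v by (intro arg_cong[where f = card]) auto
    also have "int (card {i \<in> I. h i = v}) * (int k + v - L) \<le> int g * (int k + v - L)"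
      using v mult[of v] by (intro mult_right_mono) auto
    finally show "(\<Sum>i\<in>{i \<in> ?J. h i = v}. int k + h i - L) \<le> int g * (int k + v - L)" .
  qed
  also have "\<dots> = (\<Sum>t\<in>{1..k}. int g * int t)"
    by (rule sum.reindex_bij_witness[where i = "\<lambda>t. L - int k + int t" and j = "\<lambda>v. nat (int k + v - L)"]) auto
  also have "\<dots> = int g * int (\<Sum>{1..k})" by (simp add: sum_distrib_left)
  finally have "2 * (\<Sum>i\<in>I. int k + h i - L) \<le> int g * int (2 * \<Sum>{1..k})" by simp
  also have "2 * \<Sum>{1..k} = k * (k + 1)" using double_gauss_sum_from_Suc_0[of k, where ?'a = nat] by simp
  finally have "2 * (int k * int (g * k) + (\<Sum>i\<in>I. h i) - L * int (g * k)) \<le> int g * int (k * (k + 1))"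
    using assms(2) by (simp add: sum.distrib sum_subtractf mult_ac)
  then show ?thesis by (simp add: algebra_simps)
qed

section \<open>From modular rulers to rulers on the line\<close>

text \<open>The \<open>g k\<close> cyclic gaps of \<open>A\<close> sum to \<open>M\<close>, and each gap length occurs at most \<open>g\<close> times, which
  forces a gap \<open>L\<close> longer than the average. Cutting the circle open there leaves a ruler of
  length \<open>M - L\<close>.\<close>

lemma min_diam_le_of_modular_ruler:
  fixes A :: "int set" and M :: int and g k :: nat
  assumes A: "A \<subseteq> {0..<M}" "card A = g * k" "g * k \<ge> 2"
    and rep: "\<And>d. d \<in> {0<..<M} \<Longrightarrow> card {(a, c). a \<in> A \<and> c \<in> A \<and> (c - a) mod M = d} \<le> g"
  obtains L where "int (min_diam g (g * k)) \<le> M - L"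
    and "2 * M \<le> int (g * k) * (2 * L - int k + 1)"
proof -
  define n where "n = g * k"
  have fin: "finite A" using A(1) finite_subset by blast
  have finP: "finite {(a, c). a \<in> A \<and> c \<in> A \<and> Q a c}" for Q
    by (rule finite_subset[of _ "A \<times> A"]) (use fin in auto)
  define xs where "xs = sorted_list_of_set A"
  have len: "length xs = n" and sxs: "sorted_wrt (<) xs" and setxs: "set xs = A"
    using fin A by (simp_all add: xs_def n_def)
  \<comment> \<open>\<open>b\<close> lists \<open>A\<close> in increasing order and closes the
    circle: \<open>b n\<close> is the first mark after a full turn, so \<open>h\<close> also covers
    the gap from the last mark back to the first.\<close>
  define b where "b i = (if i < n then xs ! i else xs ! 0 + M)" for i
  define h where "h i = b (Suc i) - b i" for i
  have n2: "n \<ge> 2" using A by (simp add: n_def)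
  have bA: "b i \<in> A" if "i < n" for i
    using that len setxs by (auto simp: b_def)
  have bn: "b n = b 0 + M" using n2 by (simp add: b_def)
  have b_less: "b i < b j" if "i < j" "j < n" for i j
    using that sxs len by (simp add: b_def sorted_wrt_iff_nth_less)
  have h_pos: "h i > 0" if "i < n" for i
  proof (cases "Suc i < n")
    case True
    then show ?thesis using b_less[of i "Suc i"] by (simp add: h_def)
  next
    case False
    then have "Suc i = n" using that by simp
    then have "h i = b 0 + M - b i" using bn by (simp add: h_def)
    moreover have "b i < M" "b 0 \<ge> 0" using bA[of i] bA[of 0] that A(1) by auto
    ultimately show ?thesis by linarith
  qed
  have sum_h: "(\<Sum>i<n. h i) = M"
    using sum_lessThan_telescope[of b n] bn by (simp add: h_def)
  \<comment> \<open>With at least two marks, the other gaps take a positive share of the total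
    \<open>M\<close>. Hence each gap is its own nonzero residue modulo \<open>M\<close>, and
    \<open>rep\<close> applies to it.\<close>
  have h_less: "h i < M" if i: "i < n" for i
  proof -
    have "{..<n} - {i} \<noteq> {}"
    proof
      assume "{..<n} - {i} = {}"
      then have "{..<n} \<subseteq> {i}" by blast
      then have "card {..<n} \<le> card {i}" by (intro card_mono) auto
      then show False using n2 by simp
    qed
    then have "(\<Sum>j\<in>{..<n} - {i}. h j) > 0" using h_pos by (intro sum_pos) auto
    then show ?thesis using sum_h i by (simp add: sum.remove[of "{..<n}" i])
  qed
  have b_mod: "b (Suc i) mod M \<in> A \<and> (b (Suc i) mod M - b i) mod M = h i" if i: "i < n" for i
  proof
    have "b (Suc i) mod M \<in> A"
    proof (cases "Suc i < n")
      case True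
      then show ?thesis using bA[OF True] A(1) by (auto simp: subset_iff)
    next
      case False
      then have "Suc i = n" using i by simp
      then have "b (Suc i) mod M = b 0" using bn bA[of 0] A(1) i by (auto simp: subset_iff)
      then show ?thesis using bA[of 0] i by simp
    qed
    then show "b (Suc i) mod M \<in> A" .
    show "(b (Suc i) mod M - b i) mod M = h i"
      using h_less[OF i] h_pos[OF i] by (simp add: mod_diff_left_eq h_def)
  qed
  have b_inj: "inj_on b {..<n}"
  proof (rule inj_onI)
    fix i j assume "i \<in> {..<n}" "j \<in> {..<n}" "b i = b j"
    then show "i = j" using b_less[of i j] b_less[of j i] by (cases i j rule: linorder_cases) auto
  qed
  have mult: "card {i \<in> {..<n}. h i = v} \<le> g" for v
  proof (cases "v \<in> {0<..<M}")
    case True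
    \<comment> \<open>A gap is recorded by its two end points modulo \<open>M\<close>; the left one
      alone already determines \<open>i\<close>.\<close>
    have "card {i \<in> {..<n}. h i = v} \<le> card {(a, c). a \<in> A \<and> c \<in> A \<and> (c - a) mod M = v}"
    proof (rule card_inj_on_le[where f = "\<lambda>i. (b i, b (Suc i) mod M)"])
      show "inj_on (\<lambda>i. (b i, b (Suc i) mod M)) {i \<in> {..<n}. h i = v}"
        using b_inj by (auto simp: inj_on_def)
      show "(\<lambda>i. (b i, b (Suc i) mod M)) ` {i \<in> {..<n}. h i = v} \<subseteq>
          {(a, c). a \<in> A \<and> c \<in> A \<and> (c - a) mod M = v}"
        using bA b_mod by auto
    qed (rule finP)
    then show ?thesis using rep[OF True] by linarith
  next
    case False
    then have "{i \<in> {..<n}. h i = v} = {}" using h_less h_pos by auto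
    then show ?thesis by (simp only: card.empty)
  qed
  obtain m where m: "m < n" "\<And>i. i < n \<Longrightarrow> h i \<le> h m"
  proof -
    have "Max (h ` {..<n}) \<in> h ` {..<n}" using n2 by (intro Max_in) (auto simp: lessThan_empty_iff)
    then obtain m where "m < n" "h m = Max (h ` {..<n})" by auto
    then show ?thesis using that[of m] by auto
  qed
  have bound: "2 * M \<le> int (g * k) * (2 * h m - int k + 1)"
    using sum_le_of_bounded_multiplicity[of "{..<n}" g k h "h m"] m mult sum_h
    by (simp add: n_def)

  \<comment> \<open>The cut is made in the longest gap, from \<open>b m\<close> to
    \<open>b (Suc m)\<close>: the marks up to \<open>b m\<close> move up by a full turn, so the
    ruler starts at \<open>b (Suc m)\<close> or later and ends at \<open>b m + M\<close> or
    earlier.\<close>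
  define f where "f x = (if x \<le> b m then x + M else x)" for x
  have f_mod: "f x mod M = x" if "x \<in> A" for x
    using that A(1) by (auto simp: f_def subset_iff)
  have f_inj: "inj_on f A" by (metis f_mod inj_onI)
  have f_lower: "b (Suc m) \<le> f x" if x: "x \<in> A" for x
  proof -
    obtain j where j: "j < n" "x = b j" using x setxs len by (auto simp: b_def in_set_conv_nth)
    \<comment> \<open>The case \<open>i = n\<close> serves the moved marks, which all lie at or
      above \<open>b n = b 0 + M\<close>.\<close>
    have step: "b (Suc m) \<le> b i" if "m < i" "i \<le> n" for i
    proof (cases "Suc m = i")
      case False
      show ?thesis
      proof (cases "i = n")
        case True
        have "b (Suc m) < M" "b 0 \<ge> 0" using bA[of "Suc m"] bA[of 0] that False A(1) True by auto
        then show ?thesis using True bn by simp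
      qed (use that False b_less[of "Suc m" i] in simp)
    qed simp
    show ?thesis
    proof (cases "x \<le> b m")
      case True
      have "b 0 \<le> b j" using b_less[of 0 j] j by (cases "j = 0") auto
      then show ?thesis using step[of n] m bn j True by (simp add: f_def)
    next
      case False
      then have "m < j" using b_less[of j m] j m by (metis linorder_neqE_nat order.refl less_imp_le)
      then show ?thesis using step[of j] j False by (simp add: f_def)
    qed
  qed
  have f_upper: "f x \<le> b m + M" if x: "x \<in> A" for x
  proof -
    have "x < M" "b m \<ge> 0" using x A(1) bA[OF m(1)] by auto
    then show ?thesis by (simp add: f_def)
  qed
  have ne: "f ` A \<noteq> {}" and finB: "finite (f ` A)" using bA[OF m(1)] fin by auto
  have "Max (f ` A) \<le> b m + M" "Min (f ` A) \<ge> b (Suc m)"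
    using ne finB f_upper f_lower by auto
  then have diam: "int (diam (f ` A)) \<le> M - h m"
    using h_less[OF m(1)] by (simp add: diam_def h_def)
  have "golomb_ruler g (f ` A)"
    unfolding golomb_ruler_def
  proof (intro conjI allI impI finB)
    fix d :: int assume d: "d > 0"
    let ?S = "{(a, c). a \<in> f ` A \<and> c \<in> f ` A \<and> c - a = d}"
    show "card ?S \<le> g"
    \<comment> \<open>A difference below \<open>M\<close> is a nonzero residue, so
      \<open>rep\<close> bounds its multiplicity. Larger ones do not occur, as the ruler has length
      at most \<open>M - h m < M\<close>.\<close>
    proof (cases "d < M")
      case True
      have "card ?S \<le> card {(a, c). a \<in> A \<and> c \<in> A \<and> (c - a) mod M = d}"
      proof (rule card_inj_on_le[where f = "map_prod (\<lambda>a. a mod M) (\<lambda>c. c mod M)"])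
        have "inj_on (\<lambda>a. a mod M) (f ` A)" by (auto simp: inj_on_def f_mod)
        then have "inj_on (map_prod (\<lambda>a. a mod M) (\<lambda>c. c mod M)) (f ` A \<times> f ` A)"
          by (intro map_prod_inj_on)
        then show "inj_on (map_prod (\<lambda>a. a mod M) (\<lambda>c. c mod M)) ?S"
          by (rule inj_on_subset) blast
        have "(c - a) mod M = d" if "f c - f a = d" "a \<in> A" "c \<in> A" for a c
          using mod_diff_eq[of "f c" M "f a"] that True d f_mod by simp
        then show "map_prod (\<lambda>a. a mod M) (\<lambda>c. c mod M) ` ?S \<subseteq>
            {(a, c). a \<in> A \<and> c \<in> A \<and> (c - a) mod M = d}"
          by (auto simp: f_mod)
      qed (rule finP)
      then show ?thesis using rep[of d] d True by simp
    next
      case False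
      have "f c - f a < M" if "a \<in> A" "c \<in> A" for a c
        using f_lower[OF that(1)] f_upper[OF that(2)] h_pos[OF m(1)] by (simp add: h_def)
      then have "?S = {}" using False by force
      then show ?thesis by (simp only: card.empty)
    qed
  qed
  then have "\<exists>B. golomb_ruler g B \<and> card B = g * k \<and> diam B = diam (f ` A)"
    using card_image[OF f_inj] A(2) by (intro exI[of _ "f ` A"] conjI) simp_all
  then have "min_diam g (g * k) \<le> diam (f ` A)"
    unfolding min_diam_def by (rule Least_le)
  then have "int (min_diam g (g * k)) \<le> M - h m" using diam by linarith
  then show ?thesis using bound by (rule that)
qed

section \<open>Ruzsa's construction and its reduction\<close>

text \<open>Ruzsa's set: \<open>x i\<close> is the residue modulo \<open>p (p - 1)\<close> congruent to \<open>r ^ i\<close> modulo \<open>p\<close>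
  and to \<open>i\<close> modulo \<open>p - 1\<close>, where \<open>r\<close> is a primitive root. Its nonzero differences modulo
  \<open>p (p - 1)\<close> are distinct and none is divisible by \<open>p\<close>, so it can be reduced modulo \<open>p k\<close>.\<close>

lemma modular_ruler_exists:
  fixes p g k :: nat
  assumes p: "prime p" and gk: "p - 1 = g * k"
  obtains A :: "int set" where "A \<subseteq> {0..<int (p * k)}" "card A = p - 1"
    and "\<And>d. d \<in> {0<..<int (p * k)} \<Longrightarrow>
      card {(a, c). a \<in> A \<and> c \<in> A \<and> (c - a) mod int (p * k) = d} \<le> g"
proof -
  define M where "M = int (p * k)"
  have p2: "p \<ge> 2" using p by (rule prime_ge_2_nat)
  have gk_pos: "g > 0" "k > 0" using gk p2 by (auto intro: Nat.gr0I)
  have M_pos: "M > 0" using p2 gk_pos by (simp add: M_def)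
  have primep: "prime (int p)" using p by simp
  obtain r where r: "residue_primroot p r" using prime_primitive_root_exists[of p] p p2 by auto
  define w where "w i = int r ^ i" for i
  \<comment> \<open>Chinese remaindering in closed form: \<open>p\<close> is 1 modulo
    \<open>p - 1\<close>, and \<open>-(p - 1)\<close> is 1 modulo \<open>p\<close>.\<close>
  define x where "x i = int p * int i - int (p - 1) * w i" for i
  have w_cong: "[w i = w j] (mod int p) \<longleftrightarrow> [i = j] (mod p - 1)" for i j :: nat
  proof -
    have "[w i = w j] (mod int p) \<longleftrightarrow> [r ^ i = r ^ j] (mod p)"
      by (simp add: w_def flip: cong_int_iff)
    also have "\<dots> \<longleftrightarrow> [i = j] (mod p - 1)"
      using r p by (simp add: residue_primroot_def order_divides_expdiff totient_prime)
    finally show ?thesis .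
  qed
  have w_inj: "i = j" if "[w i = w j] (mod int p)" "i < p - 1" "j < p - 1" for i j
    using that unfolding w_cong by (simp only: cong_def mod_less)
  have x_p: "[x i = w i] (mod int p)" for i
  proof -
    have "x i - w i = int p * (int i - w i)" using p2 by (simp add: x_def algebra_simps of_nat_diff)
    then show ?thesis by (simp add: cong_iff_dvd_diff)
  qed
  have x_q: "[x i = int i] (mod int (p - 1))" for i
  proof -
    have "x i - int i = int (p - 1) * (int i - w i)"
      using p2 by (simp add: x_def algebra_simps of_nat_diff)
    then show ?thesis by (simp add: cong_iff_dvd_diff)
  qed
  have x_inj: "i = j" if "[x i = x j] (mod int p)" "i < p - 1" "j < p - 1" for i j
  proof -
    have "[w i = w j] (mod int p)" using that(1) x_p by (meson cong_sym cong_trans)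
    then show ?thesis using that w_inj by blast
  qed
  \<comment> \<open>Modulo \<open>p\<close> the difference fixes \<open>w j - w i\<close>; modulo
    \<open>p - 1\<close> it fixes \<open>j - i\<close>, hence the ratio of \<open>w j\<close> to
    \<open>w i\<close>. This ratio is not 1 since \<open>i \<noteq> j\<close>, and then difference
    and ratio determine both terms. The ratio is used in cross-multiplied form.\<close>
  have sidon: "i = i' \<and> j = j'"
    if lt: "i < p - 1" "j < p - 1" "i' < p - 1" "j' < p - 1" and "i \<noteq> j"
      and D: "[x j - x i = x j' - x i'] (mod int (p * (p - 1)))" for i j i' j'
  proof -
    have Dp: "[x j - x i = x j' - x i'] (mod int p)"
      and Dq: "[x j - x i = x j' - x i'] (mod int (p - 1))"
      using D by (auto intro: cong_modulus_mult simp: mult.commute)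
    have add: "[w j - w i = w j' - w i'] (mod int p)"
      using Dp x_p by (meson cong_diff cong_sym cong_trans)
    have "[int j - int i = int j' - int i'] (mod int (p - 1))"
      using Dq x_q by (meson cong_diff cong_sym cong_trans)
    then have "[int (j + i') = int (j' + i)] (mod int (p - 1))"
      by (simp add: cong_iff_dvd_diff algebra_simps)
    then have "[w (j + i') = w (j' + i)] (mod int p)"
      by (simp only: w_cong cong_int_iff)
    then have mul: "int p dvd w j * w i' - w j' * w i"
      by (simp add: w_def power_add cong_iff_dvd_diff)
    \<comment> \<open>Subtracting \<open>w i\<close> times the additive relation from the
      multiplicative one eliminates \<open>w j'\<close> and leaves a product.\<close>
    have "int p dvd w j * w i' - w j' * w i - ((w j - w i) - (w j' - w i')) * w i"
      using add mul by (auto simp: cong_iff_dvd_diff)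
    also have "\<dots> = (w j - w i) * (w i' - w i)" by (simp add: algebra_simps)
    finally have "int p dvd w j - w i \<or> int p dvd w i' - w i"
      using primep prime_dvd_mult_iff by blast
    moreover have "\<not> int p dvd w j - w i"
      using w_inj[of j i] lt \<open>i \<noteq> j\<close> by (auto simp: cong_iff_dvd_diff)
    ultimately have "[w i' = w i] (mod int p)" by (simp add: cong_iff_dvd_diff)
    then have "i' = i" using w_inj lt by blast
    with add have "[w j = w j'] (mod int p)" by (simp add: cong_iff_dvd_diff)
    then have "j = j'" using w_inj lt by blast
    with \<open>i' = i\<close> show ?thesis by simp
  qed

  define A where "A = (\<lambda>i. x i mod M) ` {..<p - 1}"
  have "A \<subseteq> {0..<M}" using M_pos by (auto simp: A_def)
  \<comment> \<open>Reduction modulo \<open>M\<close> merges no marks: \<open>p\<close> divides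
    \<open>M\<close>, and the marks are already distinct modulo \<open>p\<close>.\<close>
  moreover have "inj_on (\<lambda>i. x i mod M) {..<p - 1}"
  proof (intro inj_onI)
    fix i j assume "i \<in> {..<p - 1}" "j \<in> {..<p - 1}" "x i mod M = x j mod M"
    moreover from this(3) have "[x i = x j] (mod int p)"
      by (auto simp: M_def cong_def[symmetric] intro: cong_modulus_mult)
    ultimately show "i = j" using x_inj by auto
  qed
  then have "card A = p - 1" by (simp add: A_def card_image)
  moreover have "card {(a, c). a \<in> A \<and> c \<in> A \<and> (c - a) mod M = d} \<le> g"
    if d: "d \<in> {0<..<M}" for d
  proof -
    let ?S = "{(i, j). i < p - 1 \<and> j < p - 1 \<and> (x j - x i) mod M = d}"
    have finS: "finite ?S" by (rule finite_subset[of _ "{..<p - 1} \<times> {..<p - 1}"]) auto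
    have "{(a, c). a \<in> A \<and> c \<in> A \<and> (c - a) mod M = d} \<subseteq> (\<lambda>(i, j). (x i mod M, x j mod M)) ` ?S"
    proof clarify
      fix a c assume ac: "a \<in> A" "c \<in> A" "d = (c - a) mod M"
      then obtain i j where ij: "i < p - 1" "j < p - 1" "a = x i mod M" "c = x j mod M"
        by (auto simp: A_def)
      then have "(x j - x i) mod M = (c - a) mod M" by (simp add: mod_diff_eq)
      with ij show "(a, c) \<in> (\<lambda>(i, j). (x i mod M, x j mod M)) `
          {(i, j). i < p - 1 \<and> j < p - 1 \<and> (x j - x i) mod M = (c - a) mod M}"
        by (intro image_eqI[of _ _ "(i, j)"]) auto
    qed
    then have "card {(a, c). a \<in> A \<and> c \<in> A \<and> (c - a) mod M = d} \<le> card ?S"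
      by (rule surj_card_le[OF finS])
    also have "\<dots> \<le> card {0..<int g}"
    \<comment> \<open>Since \<open>M * g = p * (p - 1)\<close>, the residue \<open>d\<close> modulo
      \<open>M\<close> has \<open>g\<close> lifts modulo \<open>p * (p - 1)\<close>, labelled by the
      quotient modulo \<open>g\<close>. By \<open>sidon\<close> each lift comes from at most one
      pair; \<open>d \<noteq> 0\<close> ensures \<open>i \<noteq> j\<close>.\<close>
    proof (rule card_inj_on_le[where f = "\<lambda>(i, j). (x j - x i) div M mod int g"])
      show "inj_on (\<lambda>(i, j). (x j - x i) div M mod int g) ?S"
      proof (rule inj_onI, clarify)
        fix i j i' j'
        assume lt: "i < p - 1" "j < p - 1" "i' < p - 1" "j' < p - 1"
          and "d = (x j - x i) mod M"
          and "(x j' - x i') mod M = (x j - x i) mod M"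
          and "(x j - x i) div M mod int g = (x j' - x i') div M mod int g"
        then have "[x j - x i = x j' - x i'] (mod M * int g)"
          by (simp add: cong_def zmod_zmult2_eq)
        moreover have "M * int g = int (p * (p - 1))" unfolding M_def gk by simp
        moreover have "i \<noteq> j" using d \<open>d = _\<close> by auto
        ultimately show "i = i' \<and> j = j'" using sidon lt by metis
      qed
    qed (use gk_pos in auto)
    finally show ?thesis by simp
  qed
  ultimately show ?thesis using that unfolding M_def by blast
qed

section \<open>The explicit and the asymptotic bound\<close>

lemma min_diam_bound:
  fixes p g :: nat
  assumes g: "g > 0" and p: "prime p" "odd p" "g dvd p - 1"
  shows "real (min_diam g (p - 1))
    \<le> real p * (real p - 1) / real g - real_of_int \<lceil>(3 * real p - 1 - real g) / (2 * real g)\<rceil>"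
proof -
  obtain k where gk: "p - 1 = g * k" using p(3) by blast
  have p3: "p \<ge> 3" using p prime_ge_2_nat[of p] by (cases "p = 2") auto
  obtain A where A: "A \<subseteq> {0..<int (p * k)}" "card A = p - 1"
    "\<And>d. d \<in> {0<..<int (p * k)} \<Longrightarrow>
      card {(a, c). a \<in> A \<and> c \<in> A \<and> (c - a) mod int (p * k) = d} \<le> g"
    using modular_ruler_exists[OF p(1) gk] by blast
  obtain L where L: "int (min_diam g (g * k)) \<le> int (p * k) - L"
    "2 * int (p * k) \<le> int (g * k) * (2 * L - int k + 1)"
  proof (rule min_diam_le_of_modular_ruler[of A "int (p * k)" g k])
    show "card A = g * k" "g * k \<ge> 2" using A(2) gk p3 by auto
  qed (use A in auto)
  have k: "k > 0" using gk p3 by (auto intro: Nat.gr0I)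
  \<comment> \<open>Cancelling \<open>k\<close> from the gap bound and inserting
    \<open>g * k = p - 1\<close> turns it into \<open>2 * g * L \<ge> 3 * p - 1 - g\<close>. The
    ceiling then appears because \<open>L\<close> is an integer.\<close>
  have "int k * (2 * int p) \<le> int k * (int g * (2 * L - int k + 1))"
    using L(2) by (simp add: mult_ac)
  then have "2 * int p \<le> int g * (2 * L - int k + 1)"
    using k by simp
  moreover have gk_int: "int g * int k = int p - 1"
    using gk p3 by (simp flip: of_nat_mult add: of_nat_diff)
  ultimately have "3 * int p - 1 - int g \<le> 2 * int g * L"
    by (simp add: algebra_simps)
  then have "real_of_int (3 * int p - 1 - int g) \<le> real_of_int (2 * int g * L)"
    by (simp only: of_int_le_iff)
  then have "(3 * real p - 1 - real g) / (2 * real g) \<le> real_of_int L"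
    using g by (simp add: divide_le_eq mult_ac)
  then have ceil: "\<lceil>(3 * real p - 1 - real g) / (2 * real g)\<rceil> \<le> L"
    by (simp add: ceiling_le_iff)
  have "real p - 1 = real g * real k" using arg_cong[OF gk_int, of real_of_int] by simp
  then have "real p * (real p - 1) / real g = real_of_int (int (p * k))"
    using g by simp
  moreover have "real (min_diam g (p - 1)) \<le> real_of_int (int (p * k) - L)"
    using L(1) unfolding gk by linarith
  ultimately show ?thesis using ceil by linarith
qed

theorem corollary9:
  fixes g :: nat
  assumes "g > 0"
  shows "(\<forall>p::nat. prime p \<and> odd p \<and> g dvd p - 1 \<longrightarrow>
            real (min_diam g (p - 1))
              \<le> real p * (real p - 1) / real g
                 - real_of_int \<lceil>(3 * real p - 1 - real g) / (2 * real g)\<rceil>) \<and>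
         (\<exists>(E :: nat \<Rightarrow> real) (C :: real). \<forall>p::nat. prime p \<and> odd p \<and> g dvd p - 1 \<longrightarrow>
            \<bar>E p\<bar> \<le> C \<and>
            real (min_diam g (p - 1))
              \<le> real p * (real p - 1) / real g - 3 * real p / (2 * real g) + E p)"
proof (intro conjI allI impI)
  fix p :: nat assume "prime p \<and> odd p \<and> g dvd p - 1"
  then show "real (min_diam g (p - 1)) \<le> real p * (real p - 1) / real g
      - real_of_int \<lceil>(3 * real p - 1 - real g) / (2 * real g)\<rceil>"
    using min_diam_bound assms by blast
next
  \<comment> \<open>\<open>E\<close> is exactly the discrepancy between the two bounds. The term
    \<open>(1 + g) / (2 * g)\<close> lies in \<open>[0, 1]\<close> and rounding up adds less than 1
    in the opposite direction, so the constant 1 works.\<close>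
  define E where "E p = 3 * real p / (2 * real g)
    - real_of_int \<lceil>(3 * real p - 1 - real g) / (2 * real g)\<rceil>" for p
  have "\<bar>E p\<bar> \<le> 1" for p
  proof -
    have "(3 * real p - 1 - real g) / (2 * real g) = 3 * real p / (2 * real g) - (1 + real g) / (2 * real g)"
      by (simp add: diff_divide_distrib add_divide_distrib)
    moreover have "0 \<le> (1 + real g) / (2 * real g)" "(1 + real g) / (2 * real g) \<le> 1"
      using assms by (simp_all add: divide_le_eq)
    ultimately show ?thesis unfolding E_def by linarith
  qed
  then show "\<exists>(E :: nat \<Rightarrow> real) (C :: real). \<forall>p::nat. prime p \<and> odd p \<and> g dvd p - 1 \<longrightarrow>
      \<bar>E p\<bar> \<le> C \<and>
      real (min_diam g (p - 1))
        \<le> real p * (real p - 1) / real g - 3 * real p / (2 * real g) + E p"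
    using min_diam_bound assms by (intro exI[of _ E] exI[of _ 1]) (simp add: E_def)
qed

end
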